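(* Let $D\subset\mathbb{P}^2$ be a smooth conic in the complex projective plane and let $u,v,w$ be three involutions on $D$ with distinct fixed points (the six fixed points of $u$, $v$ and $w$ are pairwise distinct). Let $x_u,x_v,x_w\in\mathbb{P}^2\setminus D$ be their respective centers. Then the product (composition) $uvw$ is an involution if and only if the points $x_u,x_v,x_w$ are aligned (collinear).
   Context: The smooth conic $D\subset\mathbb{P}^2$ is identified with $\mathbb{P}^1(\mathbb{C})$ via the Veronese embedding, so that $\mathrm{PGL}(2,\mathbb{C})$ is the automorphism group of $D$. An element $g\in\mathrm{PGL}(2,\mathbb{C})$ is called an involution (or involutive) if $g\neq I$ and $g^2=I$; in particular the identity is not an involution. An involution has exactly two fixed points on $D$; its center is the intersection point $x\notin D$ of the two tangent lines to $D$ at these fixed points. Equivalently, the involution with center $x\notin D$ exchanges the two intersection points with $D$ of each line through $x$ (a point of $D$ being fixed when the line is tangent there). *)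

theory Defs
  imports "HOL-Analysis.Analysis"
begin

section \<open>Complex projective spaces and projective linear groups\<close>

definition proj_rel :: "complex^'n \<Rightarrow> complex^'n \<Rightarrow> bool" where
  "proj_rel x y \<longleftrightarrow> x \<noteq> 0 \<and> y \<noteq> 0 \<and> (\<exists>c. c \<noteq> 0 \<and> y = c *s x)"

lemma part_equivp_proj_rel: "part_equivp (proj_rel :: complex^'n \<Rightarrow> complex^'n \<Rightarrow> bool)"
proof (rule part_equivpI)
  have "proj_rel (1 :: complex^'n) 1"
    unfolding proj_rel_def by (auto intro!: exI[of _ 1] simp: vec_eq_iff)
  then show "\<exists>x :: complex^'n. proj_rel x x" ..
  show "symp (proj_rel :: complex^'n \<Rightarrow> complex^'n \<Rightarrow> bool)"
  proof (rule sympI)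
    fix x y :: "complex^'n" assume "proj_rel x y"
    then obtain c where "c \<noteq> 0" "y = c *s x" "x \<noteq> 0" "y \<noteq> 0"
      by (auto simp: proj_rel_def)
    then show "proj_rel y x"
      unfolding proj_rel_def by (auto intro!: exI[of _ "inverse c"] simp: vec_eq_iff)
  qed
  show "transp (proj_rel :: complex^'n \<Rightarrow> complex^'n \<Rightarrow> bool)"
  proof (rule transpI)
    fix x y z :: "complex^'n" assume "proj_rel x y" "proj_rel y z"
    then obtain c d where "c \<noteq> 0" "y = c *s x" "d \<noteq> 0" "z = d *s y" "x \<noteq> 0" "z \<noteq> 0"
      by (auto simp: proj_rel_def)
    then show "proj_rel x z"
      unfolding proj_rel_def by (auto intro!: exI[of _ "d * c"] simp: vec_eq_iff)
  qed
qed

text \<open>Points are classes of nonzero vectors; \<open>2 cproj\<close> is the projective line and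
  \<open>3 cproj\<close> the projective plane.\<close>

quotient_type 'n cproj = "complex^('n::finite)" / partial: proj_rel
  by (rule part_equivp_proj_rel)

definition pgl_rel :: "complex^'n^'n \<Rightarrow> complex^'n^'n \<Rightarrow> bool" where
  "pgl_rel A B \<longleftrightarrow> invertible A \<and> invertible B \<and> (\<exists>c. c \<noteq> 0 \<and> B = mat c ** A)"

lemma mat_mult_nth: "(mat c ** A) $ i $ j = c * (A $ i $ j)"
  for A :: "complex^'n^'n"
  by (simp add: matrix_matrix_mult_def mat_def if_distrib[where f="\<lambda>x. x * _"] cong: if_cong)

lemma mat_prod_nth: "(A ** B) $ i $ j = (\<Sum>k\<in>UNIV. A $ i $ k * B $ k $ j)"
  for A B :: "complex^'n^'n"
  by (simp add: matrix_matrix_mult_def)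

lemma part_equivp_pgl_rel: "part_equivp (pgl_rel :: complex^'n^'n \<Rightarrow> complex^'n^'n \<Rightarrow> bool)"
proof (rule part_equivpI)
  have "invertible (mat 1 :: complex^'n^'n)"
    unfolding invertible_def by (auto intro!: exI[of _ "mat 1"])
  then have "pgl_rel (mat 1 :: complex^'n^'n) (mat 1)"
    unfolding pgl_rel_def by (auto intro!: exI[of _ 1])
  then show "\<exists>x :: complex^'n^'n. pgl_rel x x" ..
  show "symp (pgl_rel :: complex^'n^'n \<Rightarrow> complex^'n^'n \<Rightarrow> bool)"
  proof (rule sympI)
    fix x y :: "complex^'n^'n" assume "pgl_rel x y"
    then obtain c where "c \<noteq> 0" "y = mat c ** x" "invertible x" "invertible y"
      by (auto simp: pgl_rel_def)
    then show "pgl_rel y x"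
      unfolding pgl_rel_def by (auto intro!: exI[of _ "inverse c"] simp: vec_eq_iff mat_mult_nth)
  qed
  show "transp (pgl_rel :: complex^'n^'n \<Rightarrow> complex^'n^'n \<Rightarrow> bool)"
  proof (rule transpI)
    fix x y z :: "complex^'n^'n" assume "pgl_rel x y" "pgl_rel y z"
    then obtain c d where "c \<noteq> 0" "y = mat c ** x" "d \<noteq> 0" "z = mat d ** y"
        "invertible x" "invertible z"
      by (auto simp: pgl_rel_def)
    then show "pgl_rel x z"
      unfolding pgl_rel_def by (auto intro!: exI[of _ "d * c"] simp: vec_eq_iff mat_mult_nth)
  qed
qed

quotient_type 'n pgl = "complex^('n::finite)^'n" / partial: pgl_rel
  by (rule part_equivp_pgl_rel)

instantiation pgl :: (finite) monoid_mult
begin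

lift_definition one_pgl :: "'a pgl" is "mat 1"
  unfolding pgl_rel_def invertible_def by (auto intro!: exI[of _ 1] exI[of _ "mat 1"])

lift_definition times_pgl :: "'a pgl \<Rightarrow> 'a pgl \<Rightarrow> 'a pgl" is "(**)"
proof -
  fix A A' B B' :: "complex^'a^'a"
  assume "pgl_rel A A'" "pgl_rel B B'"
  then obtain c d where cd: "c \<noteq> 0" "A' = mat c ** A" "d \<noteq> 0" "B' = mat d ** B"
      and inv: "invertible A" "invertible A'" "invertible B" "invertible B'"
    by (auto simp: pgl_rel_def)
  have "A' ** B' = mat (c * d) ** (A ** B)"
    unfolding cd vec_eq_iff mat_mult_nth
    by (simp add: mat_prod_nth[of "mat c ** A"] mat_prod_nth[of A] mat_mult_nth
          sum_distrib_left ac_simps)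
  then show "pgl_rel (A ** B) (A' ** B')"
    unfolding pgl_rel_def using \<open>c \<noteq> 0\<close> \<open>d \<noteq> 0\<close> inv
    by (intro conjI invertible_mult exI[of _ "c * d"]) simp_all
qed

instance
proof
  fix a b c :: "'a pgl"
  show "a * b * c = a * (b * c)"
    by transfer (auto simp: pgl_rel_def matrix_mul_assoc invertible_mult intro!: exI[of _ 1])
  show "1 * a = a" by transfer (auto simp: pgl_rel_def intro!: exI[of _ 1])
  show "a * 1 = a" by transfer (auto simp: pgl_rel_def intro!: exI[of _ 1])
qed

end

lemma invertible_mult_vec_nonzero:
  fixes A :: "complex^'n^'n"
  assumes "invertible A" "x \<noteq> 0"
  shows "A *v x \<noteq> 0"
proof
  assume "A *v x = 0"
  obtain B where "B ** A = mat 1" using assms(1) by (auto simp: invertible_def)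
  then have "x = B *v (A *v x)" by (simp add: matrix_vector_mul_assoc)
  with \<open>A *v x = 0\<close> assms(2) show False by simp
qed

lift_definition pgl_app :: "'n pgl \<Rightarrow> 'n::finite cproj \<Rightarrow> 'n cproj" is "(*v)"
proof -
  fix A A' :: "complex^'n^'n" and x x' :: "complex^'n"
  assume "pgl_rel A A'" "proj_rel x x'"
  then obtain c d where cd: "c \<noteq> 0" "A' = mat c ** A" "d \<noteq> 0" "x' = d *s x"
      and nz: "invertible A" "invertible A'" "x \<noteq> 0" "x' \<noteq> 0"
    by (auto simp: pgl_rel_def proj_rel_def)
  have "A' *v x' = (c * d) *s (A *v x)"
    unfolding cd by (simp add: vec_eq_iff matrix_vector_mult_def mat_mult_nth sum_distrib_left ac_simps)
  then show "proj_rel (A *v x) (A' *v x')"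
    using cd nz invertible_mult_vec_nonzero[of A x] invertible_mult_vec_nonzero[of A' x']
    by (auto simp: proj_rel_def intro!: exI[of _ "c * d"])
qed

definition involution :: "'n::finite pgl \<Rightarrow> bool" where
  "involution g \<longleftrightarrow> g \<noteq> 1 \<and> g ^ 2 = 1"


section \<open>Lines and conics in the projective plane\<close>

text \<open>The complex bilinear pairing, not the Hermitian or the real inner product.\<close>

definition cdot :: "complex^'n \<Rightarrow> complex^'n \<Rightarrow> complex" where
  "cdot l x = (\<Sum>i\<in>UNIV. l $ i * x $ i)"

lemma cdot_scale: "cdot (c *s l) x = c * cdot l x" "cdot l (c *s x) = c * cdot l x"
  by (simp_all add: cdot_def sum_distrib_left ac_simps)

lemma mult_vec_scale: "A *v (c *s x) = c *s (A *v x)" for A :: "complex^'n^'n"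
  by (simp add: vec_eq_iff matrix_vector_mult_def sum_distrib_left ac_simps)

lift_definition on_line :: "complex^3 \<Rightarrow> 3 cproj \<Rightarrow> bool" is "\<lambda>l x. cdot l x = 0"
  by (auto simp: proj_rel_def cdot_scale)

definition collinear_points :: "3 cproj set \<Rightarrow> bool" where
  "collinear_points S \<longleftrightarrow> (\<exists>l. l \<noteq> 0 \<and> (\<forall>p\<in>S. on_line l p))"

text \<open>A conic is given by a symmetric matrix \<open>A\<close>, i.e. by the quadratic form
  \<open>F x = x\<^sup>T A x\<close>, whose gradient at \<open>x\<close> is \<open>2 A x\<close>.\<close>

lift_definition on_conic :: "complex^3^3 \<Rightarrow> 3 cproj \<Rightarrow> bool" is "\<lambda>A x. cdot x (A *v x) = 0"
  by (auto simp: proj_rel_def cdot_scale mult_vec_scale)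

definition conic :: "complex^3^3 \<Rightarrow> 3 cproj set" where
  "conic A = {p. on_conic A p}"

text \<open>Smoothness is the Jacobian criterion: the gradient vanishes at no point of the conic.\<close>

definition smooth_conic :: "complex^3^3 \<Rightarrow> bool" where
  "smooth_conic A \<longleftrightarrow> transpose A = A \<and>
     (\<forall>x. x \<noteq> 0 \<longrightarrow> cdot x (A *v x) = 0 \<longrightarrow> A *v x \<noteq> 0)"

lift_definition on_tangent :: "complex^3^3 \<Rightarrow> 3 cproj \<Rightarrow> 3 cproj \<Rightarrow> bool"
  is "\<lambda>A x y. cdot (A *v x) y = 0"
  by (auto simp: proj_rel_def cdot_scale mult_vec_scale)

text \<open>The line through \<open>p\<close> whose equation is the gradient of the quadratic form at \<open>p\<close>; it is
  the tangent line when \<open>p\<close> lies on the smooth conic.\<close>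

definition tangent_line :: "complex^3^3 \<Rightarrow> 3 cproj \<Rightarrow> 3 cproj set" where
  "tangent_line A p = {q. on_tangent A p q}"


section \<open>Identification of a smooth conic with the projective line\<close>

lift_definition veronese :: "2 cproj \<Rightarrow> 3 cproj"
  is "\<lambda>x. vector [(x $ 1)\<^sup>2, x $ 1 * x $ 2, (x $ 2)\<^sup>2]"
proof -
  fix x y :: "complex^2" assume "proj_rel x y"
  then obtain c where "c \<noteq> 0" "y = c *s x" "x \<noteq> 0"
    by (auto simp: proj_rel_def)
  then show "proj_rel (vector [(x $ 1)\<^sup>2, x $ 1 * x $ 2, (x $ 2)\<^sup>2] :: complex^3)
               (vector [(y $ 1)\<^sup>2, y $ 1 * y $ 2, (y $ 2)\<^sup>2])"
    unfolding proj_rel_def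
    by (auto intro!: exI[of _ "c\<^sup>2"] simp: vec_eq_iff forall_2 forall_3 power2_eq_square)
qed

text \<open>The Veronese embedding in arbitrary projective coordinates of the plane. It identifies the
  projective line with \<open>conic A\<close> when \<open>range (conic_param M) = conic A\<close>, and every smooth conic
  has such an \<open>M\<close>. Elements of \<open>2 pgl\<close> then act on the conic through this identification.\<close>

definition conic_param :: "3 pgl \<Rightarrow> 2 cproj \<Rightarrow> 3 cproj" where
  "conic_param M t = pgl_app M (veronese t)"

definition fixed_points :: "3 pgl \<Rightarrow> 2 pgl \<Rightarrow> 3 cproj set" where
  "fixed_points M g = conic_param M ` {t. pgl_app g t = t}"

definition center :: "complex^3^3 \<Rightarrow> 3 pgl \<Rightarrow> 2 pgl \<Rightarrow> 3 cproj" where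
  "center A M g = (THE x. x \<notin> conic A \<and> (\<forall>p\<in>fixed_points M g. x \<in> tangent_line A p))"

end

theory Submission
  imports Defs
begin

text \<open>
  An involution of the projective line is the class of an invertible \<open>2 \<times> 2\<close> matrix of trace \<open>0\<close>
  (by Cayley--Hamilton, \<open>involution_iff_trace_zero\<close>).  Such a matrix
  \<open>U = (a b; c -a)\<close> is a vector of the three-dimensional space of traceless matrices, and this
  space is the plane of the conic.  Indeed, the fixed points of \<open>U\<close> are the zeros \<open>(s, t)\<close> of
  the binary form \<open>c s\<^sup>2 - 2 a s t - b t\<^sup>2\<close>, so they are cut out on the Veronese conic
  \<open>x z = y\<^sup>2\<close> by a line, and the pole of this line has coordinates \<open>(-b, a, c)\<close>.  An arbitrary
  parametrised conic differs from the Veronese conic by a linear change of coordinates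
  (\<open>conic_polar_form\<close>), so the center of the involution is the image of \<open>(-b, a, c)\<close>
  (\<open>center_eq\<close>).

  Both sides of the equivalence thus become conditions on three traceless matrices: \<open>u v w\<close> is
  an involution when \<open>trace (U V W) = 0\<close>, and the centers are aligned when the \<open>3 \<times> 3\<close> determinant
  of the coordinates of \<open>U\<close>, \<open>V\<close>, \<open>W\<close> vanishes.  On traceless \<open>2 \<times> 2\<close> matrices the alternating
  trilinear forms \<open>trace (U V W)\<close> and \<open>det (U, V, W)\<close> are proportional
  (\<open>trace_prod_eq_det\<close>), which gives the result.
\<close>

section \<open>Representatives of points and projective transformations\<close>

lemma pgl_rel_refl: "pgl_rel A A \<longleftrightarrow> invertible A"
  by (auto simp: pgl_rel_def intro!: exI[of _ 1])

lemma proj_rel_refl: "proj_rel x x \<longleftrightarrow> x \<noteq> 0"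
  by (auto simp: proj_rel_def intro!: exI[of _ 1])

lemma pgl_cases:
  obtains A where "invertible A" "g = abs_pgl A"
  by (metis Quotient_abs_rep Quotient_pgl Quotient_rep_reflp pgl_rel_refl)

lemma cproj_cases:
  obtains x where "x \<noteq> 0" "p = abs_cproj x"
  by (metis Quotient_abs_rep Quotient_cproj Quotient_rep_reflp proj_rel_refl)

lemma abs_pgl_eq_iff:
  assumes "invertible A" "invertible B"
  shows "abs_pgl A = abs_pgl B \<longleftrightarrow> (\<exists>c. c \<noteq> 0 \<and> B = mat c ** A)"
  using Quotient_rel[OF Quotient_pgl, of A B] assms
  by (auto simp: pgl_rel_refl) (auto simp: pgl_rel_def)

lemma abs_cproj_eq_iff:
  assumes "x \<noteq> 0" "y \<noteq> 0"
  shows "abs_cproj x = abs_cproj y \<longleftrightarrow> (\<exists>c. c \<noteq> 0 \<and> y = c *s x)"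
  using Quotient_rel[OF Quotient_cproj, of x y] assms
  by (auto simp: proj_rel_refl) (auto simp: proj_rel_def)

lemma times_abs_pgl:
  "invertible A \<Longrightarrow> invertible B \<Longrightarrow> abs_pgl A * abs_pgl B = abs_pgl (A ** B)"
  by (simp add: times_pgl.abs_eq pgl_rel_refl)

lemma pgl_app_abs:
  "invertible A \<Longrightarrow> x \<noteq> 0 \<Longrightarrow> pgl_app (abs_pgl A) (abs_cproj x) = abs_cproj (A *v x)"
  by (simp add: pgl_app.abs_eq pgl_rel_refl proj_rel_refl)

section \<open>Involutions as traceless matrices\<close>

lemma invertible_2:
  "invertible (A :: complex^2^2) \<longleftrightarrow> A$1$1 * A$2$2 - A$1$2 * A$2$1 \<noteq> 0"
  by (simp add: invertible_det_nz det_2)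

lemma trace_2: "trace (A :: complex^2^2) = A$1$1 + A$2$2"
  by (simp add: trace_def sum_2)

text \<open>By Cayley--Hamilton, \<open>A\<^sup>2 = trace A \<cdot> A - det A\<close>.  Hence \<open>A\<^sup>2\<close> is scalar exactly when
  \<open>A\<close> is scalar or has trace \<open>0\<close>; the two cases exclude each other for invertible \<open>A\<close>.\<close>

lemma involution_iff_trace_zero:
  fixes A :: "complex^2^2"
  assumes "invertible A"
  shows "involution (abs_pgl A) \<longleftrightarrow> trace A = 0"
proof -
  define p q r s where pqrs: "p = A$1$1" "q = A$1$2" "r = A$2$1" "s = A$2$2"
  have d: "p * s - q * r \<noteq> 0"
    using assms by (simp add: invertible_2 pqrs)
  have i1: "invertible (mat 1 :: complex^2^2)"
    by (simp add: invertible_2 mat_def)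
  have one: "abs_pgl A = 1 \<longleftrightarrow> (\<exists>c. c \<noteq> 0 \<and> 1 = c * p \<and> 0 = c * q \<and> 0 = c * r \<and> 1 = c * s)"
    unfolding one_pgl_def abs_pgl_eq_iff[OF assms i1]
    by (simp add: vec_eq_iff forall_2 mat_mult_nth pqrs) (simp add: mat_def)
  have two: "abs_pgl A ^ 2 = 1 \<longleftrightarrow> (\<exists>c. c \<noteq> 0 \<and> 1 = c * (p * p + q * r) \<and> 0 = c * (p * q + q * s)
      \<and> 0 = c * (r * p + s * r) \<and> 1 = c * (r * q + s * s))"
    unfolding one_pgl_def power2_eq_square times_abs_pgl[OF assms assms]
      abs_pgl_eq_iff[OF invertible_mult[OF assms assms] i1]
    by (simp add: vec_eq_iff forall_2 mat_mult_nth pqrs)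
      (simp add: mat_def mat_prod_nth sum_2)
  show ?thesis
  proof
    assume inv: "involution (abs_pgl A)"
    show "trace A = 0"
    proof (rule ccontr)
      assume "trace A \<noteq> 0"
      then have t: "p + s \<noteq> 0" by (simp add: trace_2 pqrs)
      obtain c where c: "c \<noteq> 0" "1 = c * (p * p + q * r)" "0 = c * (p * q + q * s)"
          "0 = c * (r * p + s * r)" "1 = c * (r * q + s * s)"
        using inv two by (auto simp: involution_def)
      have "c * (q * (p + s)) = 0" "c * (r * (p + s)) = 0"
        using c(3,4) by (simp_all add: algebra_simps)
      then have qr: "q = 0" "r = 0" using t c(1) by auto
      have "c * ((p - s) * (p + s)) = 0" using c(2,5) qr by (simp add: algebra_simps)
      then have "p = s" using t c(1) by simp
      moreover have "p \<noteq> 0" using d qr by auto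
      ultimately have "abs_pgl A = 1"
        using qr unfolding one by (auto intro!: exI[of _ "inverse p"])
      then show False using inv by (simp add: involution_def)
    qed
  next
    assume "trace A = 0"
    then have s: "s = - p" by (simp add: trace_2 pqrs add_eq_0_iff)
    have "abs_pgl A \<noteq> 1"
      unfolding one s by (metis mult_minus_right one_neq_neg_one)
    moreover have nz: "p * p + q * r \<noteq> 0"
      using d s by (simp add: add_eq_0_iff)
    have "abs_pgl A ^ 2 = 1"
      unfolding two s using nz
      by (intro exI[of _ "inverse (p * p + q * r)"]) (auto simp: ac_simps)
    ultimately show "involution (abs_pgl A)" by (simp add: involution_def)
  qed
qed

text \<open>The fixed points are the zeros of the determinant of the pair \<open>(x, U x)\<close>, which is a binary
  quadratic form in \<open>x\<close>.\<close>

lemma pgl_app_fixed_iff: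
  fixes U :: "complex^2^2"
  assumes U: "invertible U" and x: "x \<noteq> 0"
  shows "pgl_app (abs_pgl U) (abs_cproj x) = abs_cproj x \<longleftrightarrow>
    U$2$1 * (x$1)\<^sup>2 + (U$2$2 - U$1$1) * (x$1 * x$2) - U$1$2 * (x$2)\<^sup>2 = 0"
proof -
  let ?y = "U *v x"
  have y: "?y \<noteq> 0" by (rule invertible_mult_vec_nonzero[OF U x])
  have y12: "?y$1 = U$1$1 * x$1 + U$1$2 * x$2" "?y$2 = U$2$1 * x$1 + U$2$2 * x$2"
    by (simp_all add: matrix_vector_mult_def sum_2)
  have "(\<exists>c. c \<noteq> 0 \<and> ?y = c *s x) \<longleftrightarrow> x$1 * ?y$2 = x$2 * ?y$1"
  proof
    assume eq: "x$1 * ?y$2 = x$2 * ?y$1"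
    obtain c where c: "?y = c *s x"
    proof (cases "x$1 = 0")
      case True
      then have "x$2 \<noteq> 0" using x by (auto simp: vec_eq_iff forall_2)
      then show ?thesis using eq True
        by (intro that[of "?y$2 / x$2"]) (simp add: vec_eq_iff forall_2)
    next
      case False
      then show ?thesis using eq
        by (intro that[of "?y$1 / x$1"]) (simp add: vec_eq_iff forall_2 field_simps)
    qed
    then show "\<exists>c. c \<noteq> 0 \<and> ?y = c *s x" using y by (intro exI[of _ c]) auto
  qed auto
  also have "\<dots> \<longleftrightarrow> U$2$1 * (x$1)\<^sup>2 + (U$2$2 - U$1$1) * (x$1 * x$2) - U$1$2 * (x$2)\<^sup>2 = 0"
    unfolding y12 by (simp add: power2_eq_square algebra_simps)
  finally show ?thesis
    unfolding pgl_app_abs[OF U x] abs_cproj_eq_iff[OF x y, symmetric] by (metis (no_types))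
qed

section \<open>The polar form of a parametrised conic\<close>

lemma cdot_3: "cdot x y = x$1 * y$1 + x$2 * y$2 + x$3 * y$3" for x y :: "complex^3"
  by (simp add: cdot_def sum_3)

lemma cdot_commute: "cdot x y = cdot y x"
  by (simp add: cdot_def mult.commute)

lemma cdot_mult_vec: "cdot (A *v x) y = cdot x (transpose A *v y)"
  for A :: "complex^'n^'m"
proof -
  have "cdot (A *v x) y = (\<Sum>i\<in>UNIV. \<Sum>j\<in>UNIV. A$i$j * x$j * y$i)"
    by (simp add: cdot_def matrix_vector_mult_def sum_distrib_right)
  also have "\<dots> = (\<Sum>j\<in>UNIV. \<Sum>i\<in>UNIV. A$i$j * x$j * y$i)"
    by (rule sum.swap)
  also have "\<dots> = cdot x (transpose A *v y)"
    by (simp add: cdot_def matrix_vector_mult_def transpose_def sum_distrib_left ac_simps)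
  finally show ?thesis .
qed

definition veronese_vec :: "complex^2 \<Rightarrow> complex^3" where
  "veronese_vec x = vector [(x$1)\<^sup>2, x$1 * x$2, (x$2)\<^sup>2]"

lemma veronese_vec_nth [simp]:
  "veronese_vec x $ 1 = (x$1)\<^sup>2" "veronese_vec x $ 2 = x$1 * x$2" "veronese_vec x $ 3 = (x$2)\<^sup>2"
  by (simp_all add: veronese_vec_def)

lemma veronese_vec_nonzero: "x \<noteq> 0 \<Longrightarrow> veronese_vec x \<noteq> 0"
  by (auto simp: vec_eq_iff forall_2 forall_3)

lemma conic_param_abs:
  assumes "invertible T" "x \<noteq> 0"
  shows "conic_param (abs_pgl T) (abs_cproj x) = abs_cproj (T *v veronese_vec x)"
  using assms veronese_vec_nonzero[of x]
  by (simp add: conic_param_def veronese.abs_eq proj_rel_refl flip: veronese_vec_def)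
    (simp add: pgl_app_abs)

lemma on_conic_abs: "x \<noteq> 0 \<Longrightarrow> abs_cproj x \<in> conic A \<longleftrightarrow> cdot (A *v x) x = 0"
  by (simp add: conic_def on_conic.abs_eq proj_rel_refl cdot_commute)

lemma tangent_line_abs:
  "x \<noteq> 0 \<Longrightarrow> y \<noteq> 0 \<Longrightarrow> abs_cproj y \<in> tangent_line A (abs_cproj x) \<longleftrightarrow> cdot (A *v x) y = 0"
  by (simp add: tangent_line_def on_tangent.abs_eq proj_rel_refl)

text \<open>In the coordinates of the parametrisation, the quadratic form of the conic vanishes on the
  Veronese curve, so it is a multiple of \<open>x z - y\<^sup>2\<close>: a ternary quadratic form pulls back to a
  binary quartic, and five points on the line suffice to see that the quartic is zero.  Smoothness
  makes the multiple nonzero.\<close>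

lemma conic_polar_form:
  fixes A T :: "complex^3^3"
  assumes smooth: "smooth_conic A" and T: "invertible T"
    and param: "range (conic_param (abs_pgl T)) \<subseteq> conic A"
  obtains k where "k \<noteq> 0"
    "\<And>x y. cdot (A *v (T *v x)) (T *v y) = k * (x$1 * y$3 - 2 * (x$2 * y$2) + x$3 * y$1)"
proof -
  define N where "N = transpose T ** A ** T"
  have N: "cdot (A *v (T *v x)) (T *v y) = cdot (N *v x) y" for x y
    by (subst cdot_commute, subst cdot_mult_vec)
      (simp add: N_def cdot_commute matrix_vector_mul_assoc matrix_mul_assoc)
  have "transpose N = N"
    using smooth
    by (simp add: N_def smooth_conic_def matrix_transpose_mul matrix_mul_assoc)
  then have entries: "transpose N $ i $ j = N$i$j" for i j by simp
  have sym: "N$i$j = N$j$i" for i j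
    using entries[of i j] by (simp add: transpose_def)
  have expand: "cdot (N *v x) y =
      (N$1$1 * x$1 + N$1$2 * x$2 + N$1$3 * x$3) * y$1 +
      (N$1$2 * x$1 + N$2$2 * x$2 + N$2$3 * x$3) * y$2 +
      (N$1$3 * x$1 + N$2$3 * x$2 + N$3$3 * x$3) * y$3" for x y
    by (simp add: cdot_3 matrix_vector_mult_def sum_3 sym[of 2 1] sym[of 3 1] sym[of 3 2])
  have zero: "cdot (N *v veronese_vec x) (veronese_vec x) = 0" if "x \<noteq> 0" for x
  proof -
    have "abs_cproj (T *v veronese_vec x) \<in> conic A"
      using param conic_param_abs[OF T that] by (metis range_subsetD)
    then show ?thesis
      using on_conic_abs invertible_mult_vec_nonzero[OF T veronese_vec_nonzero[OF that]]
      by (simp add: N)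
  qed
  have quartic: "N$1$1 * s^4 + 2 * N$1$2 * s^3 * t + (2 * N$1$3 + N$2$2) * s^2 * t^2
      + 2 * N$2$3 * s * t^3 + N$3$3 * t^4 = 0" if "s \<noteq> 0 \<or> t \<noteq> 0" for s t
  proof -
    have "vector [s, t] \<noteq> (0 :: complex^2)"
      using that by (auto simp: vec_eq_iff forall_2)
    from zero[OF this] show ?thesis
      by (simp add: expand algebra_simps power2_eq_square power3_eq_cube power4_eq_xxxx)
  qed
  have n11: "N$1$1 = 0" using quartic[of 1 0] by simp
  have n33: "N$3$3 = 0" using quartic[of 0 1] by simp
  have e1: "2 * N$1$2 + (2 * N$1$3 + N$2$2) + 2 * N$2$3 = 0"
    using quartic[of 1 1] n11 n33 by simp
  have e2: "- 2 * N$1$2 + (2 * N$1$3 + N$2$2) - 2 * N$2$3 = 0"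
    using quartic[of 1 "-1"] n11 n33 by simp
  have e3: "4 * N$1$2 + 4 * (2 * N$1$3 + N$2$2) + 16 * N$2$3 = 0"
    using quartic[of 1 2] n11 n33 by (simp add: algebra_simps)
  have "2 * (2 * N$1$3 + N$2$2) = 0" using e1 e2 by algebra
  then have n22: "N$2$2 = - 2 * N$1$3" by (simp add: add_eq_0_iff)
  have n23: "N$2$3 = 0" using e1 e3 n22 by algebra
  have n12: "N$1$2 = 0" using e1 n22 n23 by simp
  have form: "cdot (A *v (T *v x)) (T *v y)
      = N$1$3 * (x$1 * y$3 - 2 * (x$2 * y$2) + x$3 * y$1)" for x y
    unfolding N expand by (simp add: n11 n12 n22 n23 n33 algebra_simps)
  have "N$1$3 \<noteq> 0"
  proof
    \<comment> \<open>Otherwise \<open>A = 0\<close>, so every point would be a singular point of the conic.\<close>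
    assume "N$1$3 = 0"
    then have null: "cdot (A *v (T *v x)) (T *v y) = 0" for x y by (simp add: form)
    obtain S where S: "T ** S = mat 1" using T by (auto simp: invertible_def)
    have dot0: "cdot (A *v x) y = 0" for x y
      using null[of "S *v x" "S *v y"] by (simp add: matrix_vector_mul_assoc S)
    have "A *v x = 0" for x
      using dot0[of x "axis 1 1"] dot0[of x "axis 2 1"] dot0[of x "axis 3 1"]
      by (simp add: cdot_3 vec_eq_iff forall_3 axis_def)
    moreover have "(1 :: complex^3) \<noteq> 0" by (simp add: vec_eq_iff)
    ultimately show False
      using smooth dot0[of 1 1] unfolding smooth_conic_def by (metis cdot_commute)
  qed
  then show thesis using form that by blast
qed

section \<open>The center of an involution\<close>

text \<open>For \<open>U = (a b; c -a)\<close>, this is the pole with respect to \<open>x z = y\<^sup>2\<close> of the line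
  \<open>c x - 2 a y - b z = 0\<close> through the two fixed points of \<open>U\<close> on the Veronese conic.\<close>

definition center_vec :: "complex^2^2 \<Rightarrow> complex^3" where
  "center_vec U = vector [- (U$1$2), U$1$1, U$2$1]"

lemma center_vec_nth [simp]:
  "center_vec U $ 1 = - (U$1$2)" "center_vec U $ 2 = U$1$1" "center_vec U $ 3 = U$2$1"
  by (simp_all add: center_vec_def)

text \<open>A binary quadratic form is determined up to a factor by two distinct zeros; the form
  \<open>c s\<^sup>2 - 2 a s t - b t\<^sup>2\<close> has distinct zeros because its discriminant is \<open>4 (a\<^sup>2 + b c)\<close>.\<close>

lemma quadratic_form_proportional:
  fixes a b c :: complex and y :: "complex^3"
  assumes nz: "a * a + b * c \<noteq> 0"
    and zeros: "\<And>s t. s \<noteq> 0 \<or> t \<noteq> 0 \<Longrightarrow> c * s\<^sup>2 - 2 * a * (s * t) - b * t\<^sup>2 = 0 \<Longrightarrow>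
      y$3 * s\<^sup>2 - 2 * y$2 * (s * t) + y$1 * t\<^sup>2 = 0"
  obtains k where "y$1 = - k * b" "y$2 = k * a" "y$3 = k * c"
  \<comment> \<open>The zeros are \<open>(1, 0)\<close> and \<open>(b, -2 a)\<close> if \<open>c = 0\<close>, and \<open>(a \<plusminus> e, c)\<close> with
    \<open>e\<^sup>2 = a\<^sup>2 + b c\<close> otherwise.\<close>
proof (cases "c = 0")
  case True
  then have a: "a \<noteq> 0" using nz by auto
  have y3: "y$3 = 0" using zeros[of 1 0] True by simp
  have "y$3 * b\<^sup>2 - 2 * y$2 * (b * (- 2 * a)) + y$1 * (- 2 * a)\<^sup>2 = 0"
    using a True by (intro zeros) (auto simp: power2_eq_square)
  then have "4 * a * (y$2 * b + y$1 * a) = 0"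
    using y3 by (simp add: power2_eq_square algebra_simps)
  then have "y$1 * a = - y$2 * b" using a by (simp add: eq_neg_iff_add_eq_0 add.commute)
  then show ?thesis
    using a y3 True by (intro that[of "y$2 / a"]) (auto simp: field_simps)
next
  case False
  define e where "e = csqrt (a * a + b * c)"
  have e: "e * e = a * a + b * c"
    by (metis e_def power2_csqrt power2_eq_square)
  have "e \<noteq> 0" using nz e by auto
  have z1: "y$3 * (a + e)\<^sup>2 - 2 * y$2 * ((a + e) * c) + y$1 * c\<^sup>2 = 0"
    by (intro zeros) (use False e in \<open>auto, algebra\<close>)
  have z2: "y$3 * (a - e)\<^sup>2 - 2 * y$2 * ((a - e) * c) + y$1 * c\<^sup>2 = 0"
    by (intro zeros) (use False e in \<open>auto, algebra\<close>)
  have "4 * e * (y$3 * a - y$2 * c) = 0" using z1 z2 by algebra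
  then have y2: "y$2 * c = y$3 * a" using \<open>e \<noteq> 0\<close> by simp
  have "c * (y$1 * c + y$3 * b) = 0" using z1 y2 e by algebra
  then have "y$1 * c = - y$3 * b" using False by (simp add: eq_neg_iff_add_eq_0)
  then show ?thesis
    using y2 False by (intro that[of "y$3 / c"]) (auto simp: field_simps)
qed

text \<open>A point lies on the tangents at the two fixed points exactly when its polar line passes
  through them, that is, when the polar restricts on the conic to a multiple of the binary form of
  the fixed points.\<close>

lemma center_eq:
  fixes A T :: "complex^3^3" and U :: "complex^2^2"
  assumes smooth: "smooth_conic A" and T: "invertible T"
    and param: "range (conic_param (abs_pgl T)) \<subseteq> conic A"
    and U: "invertible U" and tr: "trace U = 0"
  shows "center A (abs_pgl T) (abs_pgl U) = abs_cproj (T *v center_vec U)"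
    and "center_vec U \<noteq> 0"
proof -
  obtain k where k: "k \<noteq> 0" and polar:
    "\<And>x y. cdot (A *v (T *v x)) (T *v y) = k * (x$1 * y$3 - 2 * (x$2 * y$2) + x$3 * y$1)"
    using conic_polar_form[OF smooth T param] by blast
  define a b c where abc: "a = U$1$1" "b = U$1$2" "c = U$2$1"
  have u22: "U$2$2 = - a" using tr by (simp add: trace_2 abc add_eq_0_iff)
  have d: "a * a + b * c \<noteq> 0"
    using U u22 by (simp add: invertible_2 abc add_eq_0_iff)
  show nz: "center_vec U \<noteq> 0"
    using d by (auto simp: vec_eq_iff forall_3 abc)
  have fixed: "fixed_points (abs_pgl T) (abs_pgl U) =
      {abs_cproj (T *v veronese_vec x) |x. x \<noteq> 0 \<and>
        c * (x$1)\<^sup>2 - 2 * a * (x$1 * x$2) - b * (x$2)\<^sup>2 = 0}" (is "_ = ?F")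
  proof -
    have eq: "pgl_app (abs_pgl U) (abs_cproj x) = abs_cproj x \<longleftrightarrow>
        c * (x$1)\<^sup>2 - 2 * a * (x$1 * x$2) - b * (x$2)\<^sup>2 = 0" if "x \<noteq> 0" for x
      unfolding pgl_app_fixed_iff[OF U that] u22 by (simp add: abc algebra_simps)
    show ?thesis
    proof (intro equalityI subsetI)
      fix p assume "p \<in> fixed_points (abs_pgl T) (abs_pgl U)"
      then obtain t where t: "pgl_app (abs_pgl U) t = t" "p = conic_param (abs_pgl T) t"
        by (auto simp: fixed_points_def)
      obtain x where "x \<noteq> 0" "t = abs_cproj x" by (rule cproj_cases)
      then show "p \<in> ?F" using t eq conic_param_abs[OF T] by auto
    next
      fix p assume "p \<in> ?F"
      then obtain x where x: "x \<noteq> 0" "p = abs_cproj (T *v veronese_vec x)"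
          "c * (x$1)\<^sup>2 - 2 * a * (x$1 * x$2) - b * (x$2)\<^sup>2 = 0"
        by blast
      then have "pgl_app (abs_pgl U) (abs_cproj x) = abs_cproj x" using eq by simp
      then show "p \<in> fixed_points (abs_pgl T) (abs_pgl U)"
        unfolding fixed_points_def x(2) conic_param_abs[OF T x(1), symmetric] by blast
    qed
  qed
  have Tnz: "T *v y \<noteq> 0" if "y \<noteq> 0" for y
    by (rule invertible_mult_vec_nonzero[OF T that])
  have tangent: "abs_cproj (T *v y) \<in> tangent_line A (abs_cproj (T *v veronese_vec x)) \<longleftrightarrow>
      y$3 * (x$1)\<^sup>2 - 2 * y$2 * (x$1 * x$2) + y$1 * (x$2)\<^sup>2 = 0" if "x \<noteq> 0" "y \<noteq> 0" for x y
  proof -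
    have "k * ((x$1)\<^sup>2 * y$3 - 2 * (x$1 * x$2 * y$2) + (x$2)\<^sup>2 * y$1) = 0 \<longleftrightarrow>
        y$3 * (x$1)\<^sup>2 - 2 * y$2 * (x$1 * x$2) + y$1 * (x$2)\<^sup>2 = 0"
      unfolding mult_eq_0_iff using k by (simp add: ac_simps)
    then show ?thesis
      unfolding tangent_line_abs[OF Tnz[OF veronese_vec_nonzero[OF that(1)]] Tnz[OF that(2)]] polar
      by simp
  qed
  show "center A (abs_pgl T) (abs_pgl U) = abs_cproj (T *v center_vec U)"
    unfolding center_def
  proof (rule the_equality, intro conjI ballI)
    have "cdot (A *v (T *v center_vec U)) (T *v center_vec U) = k * (- 2) * (a * a + b * c)"
      unfolding polar by (simp add: abc algebra_simps)
    then show "abs_cproj (T *v center_vec U) \<notin> conic A"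
      using on_conic_abs[OF Tnz[OF nz]] k d by simp
  next
    fix p assume "p \<in> fixed_points (abs_pgl T) (abs_pgl U)"
    then obtain x where x: "x \<noteq> 0" "p = abs_cproj (T *v veronese_vec x)"
        "c * (x$1)\<^sup>2 - 2 * a * (x$1 * x$2) - b * (x$2)\<^sup>2 = 0"
      unfolding fixed by blast
    show "abs_cproj (T *v center_vec U) \<in> tangent_line A p"
      unfolding x(2) tangent[OF x(1) nz] using x(3) by (simp add: abc)
  next
    fix q assume q: "q \<notin> conic A \<and> (\<forall>p\<in>fixed_points (abs_pgl T) (abs_pgl U). q \<in> tangent_line A p)"
    obtain z where z: "z \<noteq> 0" "q = abs_cproj z" by (rule cproj_cases)
    obtain S where S: "T ** S = mat 1" using T by (auto simp: invertible_def)
    define y where "y = S *v z"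
    have Ty: "T *v y = z" by (simp add: y_def matrix_vector_mul_assoc S)
    then have y: "y \<noteq> 0" using z(1) by auto
    have "y$3 * s\<^sup>2 - 2 * y$2 * (s * t) + y$1 * t\<^sup>2 = 0"
      if "s \<noteq> 0 \<or> t \<noteq> 0" "c * s\<^sup>2 - 2 * a * (s * t) - b * t\<^sup>2 = 0" for s t
    proof -
      let ?x = "vector [s, t] :: complex^2"
      have x: "?x \<noteq> 0" using that(1) by (auto simp: vec_eq_iff forall_2)
      have "abs_cproj (T *v veronese_vec ?x) \<in> fixed_points (abs_pgl T) (abs_pgl U)"
        unfolding fixed using x that(2) by (auto intro!: exI[of _ ?x])
      then have "abs_cproj (T *v y) \<in> tangent_line A (abs_cproj (T *v veronese_vec ?x))"
        using q z(2) Ty by simp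
      then show ?thesis unfolding tangent[OF x y] by simp
    qed
    then obtain l where l: "y$1 = - l * b" "y$2 = l * a" "y$3 = l * c"
      using quadratic_form_proportional[OF d] by blast
    then have yl: "y = l *s center_vec U" by (simp add: vec_eq_iff forall_3 abc)
    then have "l \<noteq> 0" using y by auto
    moreover have "z = l *s (T *v center_vec U)"
      using Ty yl by (simp add: mult_vec_scale)
    ultimately show "q = abs_cproj (T *v center_vec U)"
      unfolding z(2) using abs_cproj_eq_iff[OF Tnz[OF nz] z(1)] by auto
  qed
qed

section \<open>Alignment as vanishing of a trace\<close>

text \<open>The coordinate change \<open>T\<close> acts on the equations of lines through its transpose, so a line
  through the three points is a nonzero vector in the kernel of the matrix with rows \<open>x, y, z\<close>.\<close>

lemma collinear_points_iff_det:
  fixes T :: "complex^3^3"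
  assumes T: "invertible T" and nz: "x \<noteq> 0" "y \<noteq> 0" "z \<noteq> 0"
  shows "collinear_points {abs_cproj (T *v x), abs_cproj (T *v y), abs_cproj (T *v z)} \<longleftrightarrow>
    det (vector [x, y, z] :: complex^3^3) = 0"
proof -
  let ?P = "vector [x, y, z] :: complex^3^3"
  have on_line: "on_line l (abs_cproj (T *v v)) \<longleftrightarrow> cdot v (transpose T *v l) = 0"
    if "v \<noteq> 0" for l v
    using invertible_mult_vec_nonzero[OF T that]
    by (simp add: on_line.abs_eq proj_rel_refl cdot_commute[of l] cdot_mult_vec)
  have ker: "?P *v m = 0 \<longleftrightarrow> cdot x m = 0 \<and> cdot y m = 0 \<and> cdot z m = 0" for m
    by (simp add: vec_eq_iff forall_3 matrix_vector_mult_def cdot_def)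
  have tT: "invertible (transpose T)" using T by (simp add: invertible_det_nz)
  then obtain S where S: "transpose T ** S = mat 1" by (auto simp: invertible_def)
  have "collinear_points {abs_cproj (T *v x), abs_cproj (T *v y), abs_cproj (T *v z)} \<longleftrightarrow>
      (\<exists>l. l \<noteq> 0 \<and> ?P *v (transpose T *v l) = 0)"
    by (simp add: collinear_points_def on_line nz ker)
  also have "\<dots> \<longleftrightarrow> (\<exists>m. m \<noteq> 0 \<and> ?P *v m = 0)"
  proof
    assume "\<exists>m. m \<noteq> 0 \<and> ?P *v m = 0"
    then obtain m where m: "m \<noteq> 0" "?P *v m = 0" by blast
    have Sm: "transpose T *v (S *v m) = m" by (simp add: matrix_vector_mul_assoc S)
    then have "S *v m \<noteq> 0" using m(1) by auto
    then show "\<exists>l. l \<noteq> 0 \<and> ?P *v (transpose T *v l) = 0" using Sm m(2) by metis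
  qed (use invertible_mult_vec_nonzero[OF tT] in blast)
  also have "\<dots> \<longleftrightarrow> det ?P = 0"
    using matrix_left_invertible_ker[of ?P] invertible_left_inverse[of ?P]
      invertible_det_nz[of ?P] by blast
  finally show ?thesis .
qed

text \<open>A traceless \<open>2 \<times> 2\<close> matrix is the negative of its adjugate, and taking adjugates reverses
  products and preserves traces; so \<open>trace (U V W) = - trace (W V U)\<close>, and with cyclicity the
  trace is alternating.  On a three-dimensional space such a trilinear form is a multiple of the
  determinant; in the coordinates \<open>(-b, a, c)\<close> the factor is \<open>1\<close>.\<close>

lemma trace_prod_eq_det:
  fixes U V W :: "complex^2^2"
  assumes "trace U = 0" "trace V = 0" "trace W = 0"
  shows "trace (U ** V ** W) = det (vector [center_vec U, center_vec V, center_vec W] :: complex^3^3)"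
proof -
  have "U$2$2 = - U$1$1" "V$2$2 = - V$1$1" "W$2$2 = - W$1$1"
    using assms by (simp_all add: trace_2 add_eq_0_iff)
  then show ?thesis
    by (simp add: trace_2 mat_prod_nth sum_2 det_3 algebra_simps)
qed

theorem proposition2p4:
  fixes A :: "complex^3^3" and M :: "3 pgl" and u v w :: "2 pgl"
  assumes "smooth_conic A"
    and "range (conic_param M) = conic A"
    and "involution u" and "involution v" and "involution w"
    and "fixed_points M u \<inter> fixed_points M v = {}"
    and "fixed_points M u \<inter> fixed_points M w = {}"
    and "fixed_points M v \<inter> fixed_points M w = {}"
  shows "involution (u * v * w) \<longleftrightarrow>
    collinear_points {center A M u, center A M v, center A M w}"
proof -
  obtain T where T: "invertible T" "M = abs_pgl T" by (rule pgl_cases)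
  obtain U where U: "invertible U" "u = abs_pgl U" by (rule pgl_cases)
  obtain V where V: "invertible V" "v = abs_pgl V" by (rule pgl_cases)
  obtain W where W: "invertible W" "w = abs_pgl W" by (rule pgl_cases)
  have tr: "trace U = 0" "trace V = 0" "trace W = 0"
    using assms(3-5) U V W involution_iff_trace_zero by auto
  have param: "range (conic_param (abs_pgl T)) \<subseteq> conic A" using assms(2) T(2) by simp
  note center = center_eq[OF assms(1) T(1) param]
  have "involution (u * v * w) \<longleftrightarrow> trace (U ** V ** W) = 0"
    unfolding U(2) V(2) W(2)
    by (simp add: times_abs_pgl U V W invertible_mult involution_iff_trace_zero)
  also have "\<dots> \<longleftrightarrow> det (vector [center_vec U, center_vec V, center_vec W] :: complex^3^3) = 0"
    by (simp add: trace_prod_eq_det[OF tr])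
  also have "\<dots> \<longleftrightarrow> collinear_points {center A M u, center A M v, center A M w}"
    unfolding T(2) U(2) V(2) W(2)
      center(1)[OF U(1) tr(1)] center(1)[OF V(1) tr(2)] center(1)[OF W(1) tr(3)]
    using collinear_points_iff_det[OF T(1) center(2)[OF U(1) tr(1)] center(2)[OF V(1) tr(2)]
        center(2)[OF W(1) tr(3)]] by simp
  finally show ?thesis .
qed

end
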